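(* For all real $\alpha\ge0$, $\log^*(\alpha)-\log^*(\log^*(\alpha)+1)-1\le\log^{\circledast}(\alpha)\le\log^*(\alpha)$.
   Context: All logarithms are base 2, and $\log(x)$ means $\log_2(\max(1,x))$. $\log^{[k]}$ denotes $k$-fold iteration of $\log$, with $\log^{[0]}$ the identity. For real $\alpha\ge0$, $\log^*(\alpha)$ is the smallest natural number $k$ such that $\log^{[k]}(\alpha)\le1$. For real $\alpha>0$, $\log^{\circledast}(\alpha)$ is the largest natural number $k$ such that $\log^{[k]}(\alpha)\ge k$; and $\log^{\circledast}(0)=0$. *)

theory Defs
  imports Complex_Main
begin

definition lg :: "real \<Rightarrow> real" where
  "lg x = log 2 (max 1 x)"

definition log_star :: "real \<Rightarrow> nat" where
  "log_star \<alpha> = (LEAST k. (lg ^^ k) \<alpha> \<le> 1)"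

text \<open>
  For \<open>\<alpha> > 0\<close> the maximum exists: \<open>k = 0\<close> qualifies, and the iterates are eventually 0,
  so only finitely many \<open>k\<close> do.
\<close>

definition log_circledast :: "real \<Rightarrow> nat" where
  "log_circledast \<alpha> = (if \<alpha> = 0 then 0 else (GREATEST k. (lg ^^ k) \<alpha> \<ge> real k))"

end

(*
  Write n for log_star alpha, m for log_star (n + 1) and k = n - m - 1.  If the k-th iterate were
  below k, hence below n + 1, then m further steps would bring it to at most 1, so that
  n <= m + k = n - 1.  For the upper bound, one step past n the iterates are all 0.
*)
theory Submission
  imports Defs
begin

lemma lg_mono: "mono lg"
  by (rule monoI) (auto simp: lg_def)

lemma lg_eq_0: "x \<le> 1 \<Longrightarrow> lg x = 0"
  by (simp add: lg_def)

text \<open>Since n + 2 \<le> 2^(n + 1), one application of \<open>lg\<close> lowers the bound n + 2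
  to n + 1. By the Archimedean property this makes some iterate at most 1, so the minimum in
  \<open>log_star\<close> is attained.\<close>

lemma funpow_lg_le_1:
  assumes "x \<le> real (Suc n)"
  shows "(lg ^^ n) x \<le> 1"
  using assms
proof (induction n arbitrary: x)
  case 0
  then show ?case by simp
next
  case (Suc n)
  have "real (Suc (Suc n)) \<le> real (2 ^ Suc n)"
    by (subst of_nat_le_iff) (metis Suc_leI less_exp)
  with Suc.prems have "max 1 x \<le> 2 ^ Suc n"
    by simp
  then have "lg x \<le> real (Suc n)"
    by (simp add: lg_def log_le_iff powr_realpow [symmetric] del: power_Suc of_nat_Suc)
  then show ?case
    using Suc.IH by (simp add: funpow_swap1 del: of_nat_Suc)
qed

lemma funpow_lg_log_star_le_1: "(lg ^^ log_star x) x \<le> 1"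
proof -
  obtain n where "x \<le> real n"
    using real_arch_simple by blast
  then have "(lg ^^ n) x \<le> 1"
    by (intro funpow_lg_le_1) simp
  then show ?thesis
    unfolding log_star_def by (rule LeastI)
qed

lemma log_star_le: "(lg ^^ k) x \<le> 1 \<Longrightarrow> log_star x \<le> k"
  unfolding log_star_def by (rule Least_le)

lemma funpow_lg_eq_0:
  assumes "log_star x < k"
  shows "(lg ^^ k) x = 0"
proof -
  have "(lg ^^ Suc (log_star x + d)) x = 0" for d
  proof (induction d)
    case 0
    show ?case
      using funpow_lg_log_star_le_1 by (simp add: lg_eq_0)
  next
    case (Suc d)
    then show ?case by (simp add: lg_eq_0)
  qed
  with assms show ?thesis
    by (metis less_iff_Suc_add)
qed

text \<open>For k beyond \<open>log_star x\<close> the iterate is 0, which would force k = 0. This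
  bounds the candidates in \<open>log_circledast\<close>.\<close>

lemma le_log_star:
  assumes "real k \<le> (lg ^^ k) x"
  shows "k \<le> log_star x"
  using assms funpow_lg_eq_0 [of x k] by (cases "log_star x < k") auto

lemma log_circledast_le_log_star:
  assumes "\<alpha> \<ge> 0"
  shows "log_circledast \<alpha> \<le> log_star \<alpha>"
proof -
  have "real (GREATEST k. real k \<le> (lg ^^ k) \<alpha>)
      \<le> (lg ^^ (GREATEST k. real k \<le> (lg ^^ k) \<alpha>)) \<alpha>"
    \<comment> \<open>The greatest candidate exists: 0 qualifies because \<alpha> \<ge> 0, and
      \<open>log_star \<alpha>\<close> bounds all candidates.\<close>
    by (rule GreatestI_nat [where k = 0 and b = "log_star \<alpha>"])
      (use assms le_log_star in auto)
  then show ?thesis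
    by (simp add: log_circledast_def le_log_star)
qed

lemma le_log_circledast:
  assumes "\<alpha> \<noteq> 0" and "real k \<le> (lg ^^ k) \<alpha>"
  shows "k \<le> log_circledast \<alpha>"
  using assms le_log_star
  by (auto simp: log_circledast_def intro: Greatest_le_nat [where b = "log_star \<alpha>"])

text \<open>Iterates of the monotone \<open>lg\<close> are monotone, so the
  \<open>log_star y\<close> steps that bring y to at most 1 do the same for the k-th iterate of
  x.\<close>

lemma log_star_le_add:
  assumes "(lg ^^ k) x \<le> y"
  shows "log_star x \<le> log_star y + k"
proof (rule log_star_le)
  have "(lg ^^ (log_star y + k)) x \<le> (lg ^^ log_star y) y"
    using funpow_mono [OF lg_mono assms] by (simp add: funpow_add)
  also have "\<dots> \<le> 1"
    by (rule funpow_lg_log_star_le_1)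
  finally show "(lg ^^ (log_star y + k)) x \<le> 1" .
qed

theorem theorem4p17:
  fixes \<alpha> :: real
  assumes "\<alpha> \<ge> 0"
  shows "int (log_star \<alpha>) - int (log_star (real (log_star \<alpha>) + 1)) - 1 \<le> int (log_circledast \<alpha>)
    \<and> log_circledast \<alpha> \<le> log_star \<alpha>"
proof
  define n m k where "n = log_star \<alpha>" and "m = log_star (real n + 1)" and "k = n - m - 1"
  \<comment> \<open>Subtraction in k is truncated: k = 0 means n \<le> m + 1, where the integer
    lower bound is at most 0 and so trivial.\<close>
  have "k \<le> log_circledast \<alpha>" if "k > 0"
  proof (rule le_log_circledast)
    show "\<alpha> \<noteq> 0"
      \<comment> \<open>If \<alpha> were 0, it would be at most 1 before any iteration, so n = 0 and
        k = 0.\<close>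
      using that log_star_le [of 0 \<alpha>] by (auto simp: k_def n_def)
    show "real k \<le> (lg ^^ k) \<alpha>"
    proof (rule ccontr)
      assume "\<not> real k \<le> (lg ^^ k) \<alpha>"
      then have "(lg ^^ k) \<alpha> \<le> real n + 1"
        by (simp add: k_def)
      then have "n \<le> m + k"
        unfolding n_def m_def by (rule log_star_le_add)
      \<comment> \<open>As k > 0, the truncation is not in effect and m + k = n - 1.\<close>
      with that show False
        by (simp add: k_def)
    qed
  qed
  then show "int (log_star \<alpha>) - int (log_star (real (log_star \<alpha>) + 1)) - 1 \<le> int (log_circledast \<alpha>)"
    unfolding n_def [symmetric] m_def [symmetric] by (simp add: k_def) linarith
  show "log_circledast \<alpha> \<le> log_star \<alpha>"
    using assms by (rule log_circledast_le_log_star)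
qed

end
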